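(* Given any sensing graph $G_1=(V\cup V',E_1)$ and any social graph $G_2=(V,E_2)$, the welfare function $\Phi(S)$ of the static crowd-sensing scenario (without or with PoI preference) is non-decreasing and submodular in its input $S\subseteq V$.
   Context: Setting. The sensing graph is a finite undirected graph without self-loops $G_1=(V\cup V',E_1)$, where $V=\{v_1,\dots,v_m\}$ is the set of user nodes and $V'$ (disjoint from $V$) the set of nodes without users. The social graph is an undirected graph $G_2=(V,E_2)$; $N_2(v)$ is the set of neighbours of $v$ in $G_2$. For a node set $\overline V$, $E_1(\overline V)$ is the set of edges of $G_1$ incident to at least one node of $\overline V$. For $S\subseteq V$ the utility of user $v_i$ is, without PoI preference, $\phi_i(S)=|E_1(\{v_i\}\cup N_2(v_i)\cup S)|$, and, with PoI preference, $\phi_i(S)=|E_1^{(i)}\cap E_1(\{v_i\}\cup N_2(v_i)\cup S)|$ for a given subset $E_1^{(i)}\subseteq E_1$. The welfare is $\Phi(S)=\frac1m\sum_{v_i\in V}\phi_i(S)$. A set function $f$ on subsets of a finite set $V$ is submodular if $f(S\cup\{v\})-f(S)\ge f(T\cup\{v\})-f(T)$ for all $v\in V$ and all $S\subseteq T\subseteq V$; it is non-decreasing if $f(S)\le f(T)$ whenever $S\subseteq T$. *)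

theory Defs
  imports Complex_Main
begin

text \<open>Edges are unordered pairs \<open>{u, w}\<close>; a self-loop is the singleton \<open>{u, u}\<close>, so that graphs with
  and without self-loops can both be described.\<close>

definition fin_undirected_graph :: "'a set \<Rightarrow> 'a set set \<Rightarrow> bool" where
  "fin_undirected_graph V E \<longleftrightarrow> finite V \<and> (\<forall>e\<in>E. \<exists>u\<in>V. \<exists>w\<in>V. e = {u, w})"

definition loopless :: "'a set set \<Rightarrow> bool" where
  "loopless E \<longleftrightarrow> (\<forall>u. {u, u} \<notin> E)"

definition neighbours :: "'a set set \<Rightarrow> 'a \<Rightarrow> 'a set" where
  "neighbours E v = {u. {v, u} \<in> E}"

definition incident_edges :: "'a set set \<Rightarrow> 'a set \<Rightarrow> 'a set set" where
  "incident_edges E W = {e \<in> E. \<exists>w\<in>W. w \<in> e}"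

definition utility :: "'a set set \<Rightarrow> 'a set set \<Rightarrow> 'a set \<Rightarrow> 'a \<Rightarrow> nat" where
  "utility E1 E2 S v = card (incident_edges E1 ({v} \<union> neighbours E2 v \<union> S))"

text \<open>\<open>P v\<close> is the set of sensing edges preferred by user \<open>v\<close>.\<close>

definition utility_pref ::
    "'a set set \<Rightarrow> 'a set set \<Rightarrow> ('a \<Rightarrow> 'a set set) \<Rightarrow> 'a set \<Rightarrow> 'a \<Rightarrow> nat" where
  "utility_pref E1 E2 P S v = card (P v \<inter> incident_edges E1 ({v} \<union> neighbours E2 v \<union> S))"

definition welfare :: "'a set \<Rightarrow> ('a set \<Rightarrow> 'a \<Rightarrow> nat) \<Rightarrow> 'a set \<Rightarrow> real" where
  "welfare V \<phi> S = 1 / real (card V) * (\<Sum>v\<in>V. real (\<phi> S v))"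

definition submodular_on :: "'a set \<Rightarrow> ('a set \<Rightarrow> real) \<Rightarrow> bool" where
  "submodular_on V f \<longleftrightarrow>
    (\<forall>v\<in>V. \<forall>S T. S \<subseteq> T \<and> T \<subseteq> V \<longrightarrow> f (S \<union> {v}) - f S \<ge> f (T \<union> {v}) - f T)"

end

(* Every utility is a coverage function: it counts a finite set of edges F S that is monotone in S,
   and the edges gained by adding v to S are those at v outside F S, a set that shrinks
   as S grows. Monotonicity and submodularity pass to nonnegative combinations. The case without PoI
   preference is the one in which every user prefers all sensing edges. *)
theory Submission
  imports Defs
begin

text \<open>Needed because \<open>card\<close> is 0 on infinite sets, so that counting edges is
  monotone only within a finite edge set.\<close>

lemma fin_undirected_graph_finite_edges:
  assumes "fin_undirected_graph V E"
  shows "finite E"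
proof (rule finite_subset)
  show "E \<subseteq> Pow V"
    using assms by (force simp: fin_undirected_graph_def)
  show "finite (Pow V)"
    using assms by (simp add: fin_undirected_graph_def)
qed

lemma incident_edges_Un:
  "incident_edges E (A \<union> B) = incident_edges E A \<union> incident_edges E B"
  by (auto simp: incident_edges_def)

lemma incident_edges_mono:
  "A \<subseteq> B \<Longrightarrow> incident_edges E A \<subseteq> incident_edges E B"
  by (auto simp: incident_edges_def)

lemma finite_incident_edges:
  "finite E \<Longrightarrow> finite (incident_edges E A)"
  by (simp add: incident_edges_def)

text \<open>Adjoining \<open>C\<close> to a finite set \<open>X\<close> gains exactly the elements
  of \<open>C - X\<close>, and \<open>C - B \<subseteq> C - A\<close>. The differences are taken in
  \<open>real\<close> to avoid truncated subtraction on \<open>nat\<close>.\<close>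

lemma card_Un_gain_antimono:
  assumes "finite B" "finite C" "A \<subseteq> B"
  shows "real (card (B \<union> C)) - real (card B) \<le> real (card (A \<union> C)) - real (card A)"
proof -
  have gain: "real (card (X \<union> C)) - real (card X) = real (card (C - X))" if "finite X" for X
    using card_Un_disjoint[of X "C - X"] that assms(2) by simp
  have "card (C - B) \<le> card (C - A)"
    using assms by (intro card_mono) auto
  then show ?thesis
    using assms by (simp add: gain finite_subset)
qed

lemma utility_pref_mono:
  assumes "finite E1" "S \<subseteq> T"
  shows "utility_pref E1 E2 P S v \<le> utility_pref E1 E2 P T v"
  unfolding utility_pref_def using assms
  \<comment> \<open>\<open>disjI2\<close> draws finiteness of the intersection from the incident
    edges, since \<open>P v\<close> is arbitrary here.\<close>
  by (intro card_mono finite_Int disjI2 finite_incident_edges Int_mono order_refl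
      incident_edges_mono Un_mono)

lemma utility_pref_gain_antimono:
  assumes "finite E1" "S \<subseteq> T"
  shows "real (utility_pref E1 E2 P (T \<union> {u}) v) - real (utility_pref E1 E2 P T v)
    \<le> real (utility_pref E1 E2 P (S \<union> {u}) v) - real (utility_pref E1 E2 P S v)"
proof -
  define F where "F X = P v \<inter> incident_edges E1 ({v} \<union> neighbours E2 v \<union> X)" for X
  \<comment> \<open>The adjoined set of edges is the same for every \<open>X\<close>; it serves as
    \<open>C\<close> in \<open>card_Un_gain_antimono\<close>.\<close>
  have step: "F (X \<union> {u}) = F X \<union> (P v \<inter> incident_edges E1 {u})" for X
    unfolding F_def incident_edges_Un by blast
  have "F S \<subseteq> F T"
    unfolding F_def using assms(2) by (intro Int_mono order_refl incident_edges_mono Un_mono)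
  moreover have "finite (F T)"
    unfolding F_def using assms(1) by (simp add: finite_incident_edges)
  ultimately have "real (card (F (T \<union> {u}))) - real (card (F T))
      \<le> real (card (F (S \<union> {u}))) - real (card (F S))"
    unfolding step using assms(1) by (intro card_Un_gain_antimono) (simp_all add: finite_incident_edges)
  then show ?thesis
    by (simp only: utility_pref_def F_def)
qed

lemma mono_on_welfare:
  assumes "\<And>v S T. v \<in> V \<Longrightarrow> S \<subseteq> T \<Longrightarrow> T \<subseteq> V \<Longrightarrow> \<phi> S v \<le> \<phi> T v"
  shows "mono_on (Pow V) (welfare V \<phi>)"
  unfolding welfare_def using assms
  \<comment> \<open>The factor \<open>1 / real (card V)\<close> is nonnegative even for empty
    \<open>V\<close>, where division by zero gives 0.\<close>
  by (intro mono_onI mult_left_mono sum_mono) auto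

lemma submodular_on_welfare:
  assumes "\<And>u v S T. v \<in> V \<Longrightarrow> u \<in> V \<Longrightarrow> S \<subseteq> T \<Longrightarrow> T \<subseteq> V \<Longrightarrow>
    real (\<phi> (T \<union> {u}) v) - real (\<phi> T v) \<le> real (\<phi> (S \<union> {u}) v) - real (\<phi> S v)"
  shows "submodular_on V (welfare V \<phi>)"
proof -
  \<comment> \<open>Linearity turns a welfare gain into the average of the users' gains, which can
    then be compared user by user.\<close>
  have gain: "welfare V \<phi> A - welfare V \<phi> B
      = 1 / real (card V) * (\<Sum>v\<in>V. real (\<phi> A v) - real (\<phi> B v))" for A B
    by (simp add: welfare_def sum_subtractf diff_divide_distrib)
  show ?thesis
    unfolding submodular_on_def gain
    by (intro ballI allI impI mult_left_mono sum_mono assms) auto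
qed

text \<open>An equation between unapplied functions, so that it rewrites the argument of
  \<open>welfare\<close>.\<close>

lemma utility_eq_utility_pref:
  "utility E1 E2 = utility_pref E1 E2 (\<lambda>_. E1)"
proof -
  have "E1 \<inter> incident_edges E1 W = incident_edges E1 W" for W
    by (auto simp: incident_edges_def)
  then show ?thesis
    by (simp add: fun_eq_iff utility_def utility_pref_def)
qed

theorem lemma5:
  fixes V V' :: "'a set" and E1 E2 :: "'a set set"
  assumes sensing: "fin_undirected_graph (V \<union> V') E1" "loopless E1"
    and disjoint: "V \<inter> V' = {}"
    and social: "fin_undirected_graph V E2"
  shows "(mono_on (Pow V) (welfare V (utility E1 E2)) \<and>
          submodular_on V (welfare V (utility E1 E2))) \<and>
         (\<forall>P. (\<forall>v\<in>V. P v \<subseteq> E1) \<longrightarrow>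
            mono_on (Pow V) (welfare V (utility_pref E1 E2 P)) \<and>
            submodular_on V (welfare V (utility_pref E1 E2 P)))"
proof -
  have "finite E1"
    using sensing(1) by (rule fin_undirected_graph_finite_edges)
  then have "mono_on (Pow V) (welfare V (utility_pref E1 E2 P))"
    "submodular_on V (welfare V (utility_pref E1 E2 P))" for P
    \<comment> \<open>\<open>Un_insert_right\<close> would turn \<open>T \<union> {u}\<close> into
      an \<open>insert\<close> term, which \<open>utility_pref_gain_antimono\<close> does not
      match.\<close>
    by (auto intro!: mono_on_welfare submodular_on_welfare utility_pref_mono
        utility_pref_gain_antimono simp del: Un_insert_right)
  then show ?thesis
    unfolding utility_eq_utility_pref by blast
qed

end
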